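(* Let $O=(0,0)$ and $P=(1,0)$. Let $B$ be a point in the first quadrant of the lemniscate $(x^2+y^2)^2=x^2-y^2$ and let $B'$ be its radial projection onto the squircle $x^4+y^4=1$. Let $D$ be the point on the first quadrant portion of the lemniscate such that $$\overline{OD}^2=\frac{1-\overline{OB}^4}{1+\overline{OB}^4}.$$ Then $l=2a\sqrt{2}$, where $l$ is the arc length of the lemniscate (along its first quadrant portion) from $O$ to $D$, and $a$ is the area of the squircular sector $OPB'$.
   Context: The first quadrant portion of the lemniscate is the curve with polar equation $r=\sqrt{\cos(2\theta)}$, $0\le\theta\le\pi/4$, running from $P=(1,0)$ (at $\theta=0$) to the origin $O$ (at $\theta=\pi/4$). $\overline{XY}$ denotes the Euclidean distance between points $X$ and $Y$. If $B$ has polar angle $\alpha\in[0,\pi/4]$ (i.e. $B$ has polar coordinates $(\sqrt{\cos 2\alpha},\alpha)$), its radial projection $B'$ onto the squircle is the point where the ray from $O$ at angle $\alpha$ meets $x^4+y^4=1$; for $B=O$ take $\alpha=\pi/4$. The squircular sector $OPB'$ is the region enclosed by the segment $OP$, the arc of the squircle from $P$ counterclockwise to $B'$, and the segment $B'O$, i.e. the region inside $x^4+y^4=1$ with polar angle between $0$ and $\alpha$. *)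

theory Defs
  imports "HOL-Analysis.Analysis"
begin

definition first_quadrant :: "(real \<times> real) set" where
  "first_quadrant = {(x, y). 0 \<le> x \<and> 0 \<le> y}"

definition lemniscate :: "(real \<times> real) set" where
  "lemniscate = {(x, y). (x\<^sup>2 + y\<^sup>2)\<^sup>2 = x\<^sup>2 - y\<^sup>2}"

definition squircle :: "(real \<times> real) set" where
  "squircle = {(x, y). x ^ 4 + y ^ 4 = 1}"

definition polar_point :: "real \<Rightarrow> real \<Rightarrow> real \<times> real" where
  "polar_point r \<theta> = (r * cos \<theta>, r * sin \<theta>)"

definition polar_angle :: "real \<times> real \<Rightarrow> real" where
  "polar_angle X = Arg (Complex (fst X) (snd X))"

definition lemniscate_curve :: "real \<Rightarrow> real \<times> real" where
  "lemniscate_curve \<theta> = polar_point (sqrt (cos (2 * \<theta>))) \<theta>"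

text \<open>The parameter value of a point of the first-quadrant portion of the lemniscate:
  \<open>lemniscate_curve\<close> on \<open>{0..pi/4}\<close> reaches the origin, where the polar angle is not
  determined, at \<open>pi/4\<close>.\<close>

definition lemniscate_angle :: "real \<times> real \<Rightarrow> real" where
  "lemniscate_angle X = (if X = (0, 0) then pi / 4 else polar_angle X)"

definition radial_projection :: "real \<times> real \<Rightarrow> real \<times> real \<Rightarrow> bool" where
  "radial_projection B B' \<longleftrightarrow>
     B' \<in> squircle \<and> (\<exists>t\<ge>0. B' = polar_point t (lemniscate_angle B))"

definition squircular_sector :: "real \<times> real \<Rightarrow> (real \<times> real) set" where
  "squircular_sector B' =
     {polar_point r \<theta> | r \<theta>. 0 \<le> r \<and> 0 \<le> \<theta> \<and> \<theta> \<le> polar_angle B'}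
     \<inter> {(x, y). x ^ 4 + y ^ 4 \<le> 1}"

text \<open>Length of the curve \<open>\<gamma>\<close> restricted to \<open>{a..b}\<close>, where \<open>a \<le> b\<close>: the supremum of the
  lengths of the inscribed polygons.\<close>

definition arc_length :: "(real \<Rightarrow> 'a::metric_space) \<Rightarrow> real \<Rightarrow> real \<Rightarrow> ereal" where
  "arc_length \<gamma> a b =
     (SUP (n, t) \<in> {(n::nat, t::nat \<Rightarrow> real). t 0 = a \<and> t n = b \<and> (\<forall>i<n. t i \<le> t (Suc i))}.
        ereal (\<Sum>i<n. dist (\<gamma> (t i)) (\<gamma> (t (Suc i)))))"

end

theory Submission
  imports Defs
begin

text \<open>
  If \<open>B\<close> has polar angle \<open>\<alpha>\<close>, the condition on \<open>D\<close> says that its polar angle is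
  \<open>arctan (cos (2 * \<alpha>))\<close>. Under the substitution \<open>\<theta> = arctan (sin (2 * u))\<close> the lemniscate takes the
  smooth form \<open>(c / (1 + s\<^sup>2), s * c / (1 + s\<^sup>2))\<close> with \<open>s = sin (2 * u)\<close>, \<open>c = cos (2 * u)\<close>, whose speed
  is \<open>2 / sqrt (1 + s\<^sup>2)\<close>. The area of the squircular sector of angle \<open>\<theta>\<close> has derivative
  \<open>1 / (2 * sqrt (cos\<^sup>4 \<theta> + sin\<^sup>4 \<theta>)) = 1 / sqrt (2 * (1 + cos\<^sup>2 (2 * \<theta>)))\<close>. For \<open>\<theta> = pi / 4 - u\<close> the two
  rates differ by the factor \<open>2 * sqrt 2\<close>, and \<open>u\<close> runs over \<open>{pi / 4 - \<alpha>..pi / 4}\<close> as \<open>\<theta>\<close> runs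
  over \<open>{0..\<alpha>}\<close>.
\<close>

section \<open>Arc length as a supremum of chord sums\<close>

lemma partition_mono:
  fixes t :: "nat \<Rightarrow> 'a::order"
  assumes "\<forall>i<n. t i \<le> t (Suc i)" "i \<le> j" "j \<le> n"
  shows "t i \<le> t j"
  using assms(2,3)
proof (induction rule: dec_induct)
  case (step k)
  then show ?case using assms(1) by (meson Suc_le_lessD Suc_leD order_trans)
qed simp

text \<open>The parameter of \<open>lemniscate_curve\<close> is unsuitable for differentiation,
  since \<open>sqrt (cos (2 * \<theta>))\<close> has no derivative at \<open>pi / 4\<close>.
  Changing it is harmless because \<open>h\<close> matches partitions with equal chord sums: a
  partition of \<open>{c..d}\<close> is pushed forward by monotonicity, and one of the image is
  lifted by the intermediate value theorem, with injectivity fixing the endpoints.\<close>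

lemma arc_length_reparametrization:
  assumes "c \<le> d" and cont: "continuous_on {c..d} h" and mono: "strict_mono_on {c..d} h"
  shows "arc_length \<gamma> (h c) (h d) = arc_length (\<gamma> \<circ> h) c d"
proof (rule antisym)
  show "arc_length \<gamma> (h c) (h d) \<le> arc_length (\<gamma> \<circ> h) c d"
    unfolding arc_length_def
  proof (rule SUP_least, clarify)
    fix n and t :: "nat \<Rightarrow> real"
    assume t: "t 0 = h c" "t n = h d" "\<forall>i<n. t i \<le> t (Suc i)"
    have "\<exists>u\<in>{c..d}. h u = t i" if "i \<le> n" for i
    proof -
      have "h c \<le> t i" "t i \<le> h d"
        using partition_mono[OF t(3), of 0 i] partition_mono[OF t(3), of i n] t that by auto
      then show ?thesis
        using IVT'[of h c "t i" d] cont \<open>c \<le> d\<close> by auto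
    qed
    then obtain u where u: "\<And>i. i \<le> n \<Longrightarrow> u i \<in> {c..d} \<and> h (u i) = t i"
      by metis
    have inj: "inj_on h {c..d}"
      using mono by (rule strict_mono_on_imp_inj_on)
    have "u 0 = c" "u n = d"
      using u[of 0] u[of n] t \<open>c \<le> d\<close> inj by (auto simp: inj_on_def)
    moreover have "u i \<le> u (Suc i)" if "i < n" for i
      using u[of i] u[of "Suc i"] t(3) that strict_mono_on_leD[OF mono] strict_mono_onD[OF mono, of "u (Suc i)" "u i"]
      by (metis Suc_leI less_imp_le_nat linorder_not_less)
    ultimately show "ereal (\<Sum>i<n. dist (\<gamma> (t i)) (\<gamma> (t (Suc i))))
      \<le> (SUP (n, t)\<in>{(n, t). t 0 = c \<and> t n = d \<and> (\<forall>i<n. t i \<le> t (Suc i))}.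
           ereal (\<Sum>i<n. dist ((\<gamma> \<circ> h) (t i)) ((\<gamma> \<circ> h) (t (Suc i)))))"
      using u by (intro SUP_upper2[of "(n, u)"]) auto
  qed
  show "arc_length (\<gamma> \<circ> h) c d \<le> arc_length \<gamma> (h c) (h d)"
    unfolding arc_length_def
  proof (rule SUP_least, clarify)
    fix n and t :: "nat \<Rightarrow> real"
    assume t: "c = t 0" "d = t n" "\<forall>i<n. t i \<le> t (Suc i)"
    have "t i \<in> {c..d}" if "i \<le> n" for i
      using partition_mono[OF t(3), of 0 i] partition_mono[OF t(3), of i n] t that by auto
    then have "h (t i) \<le> h (t (Suc i))" if "i < n" for i
      using strict_mono_on_leD[OF mono, of "t i" "t (Suc i)"] t(3) that by simp
    then show "ereal (\<Sum>i<n. dist ((\<gamma> \<circ> h) (t i)) ((\<gamma> \<circ> h) (t (Suc i))))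
      \<le> (SUP (m, s)\<in>{(m, s). s 0 = h (t 0) \<and> s m = h (t n) \<and> (\<forall>i<m. s i \<le> s (Suc i))}.
           ereal (\<Sum>i<m. dist (\<gamma> (s i)) (\<gamma> (s (Suc i)))))"
      by (intro SUP_upper2[of "(n, h \<circ> t)"]) auto
  qed
qed

text \<open>The mean value inequality, with an antiderivative of the speed as majorant.\<close>

lemma dist_le_diff_of_norm_derivative:
  fixes \<gamma> :: "real \<Rightarrow> 'a::real_normed_vector"
  assumes \<gamma>: "\<And>t. t \<in> {a..b} \<Longrightarrow> (\<gamma> has_vector_derivative \<gamma>' t) (at t within {a..b})"
    and F: "\<And>t. t \<in> {a..b} \<Longrightarrow> (F has_real_derivative norm (\<gamma>' t)) (at t within {a..b})"
    and st: "a \<le> s" "s \<le> t" "t \<le> b"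
  shows "dist (\<gamma> s) (\<gamma> t) \<le> F t - F s"
proof (cases "s = t")
  case False
  have sub: "{s..t} \<subseteq> {a..b}" using st by auto
  have "norm (\<gamma> t - \<gamma> s) \<le> F t - F s"
  proof (rule differentiable_bound_general)
    show "s < t" using False st by simp
    have "continuous_on {a..b} \<gamma>" using \<gamma> by (rule continuous_on_vector_derivative)
    then show "continuous_on {s..t} \<gamma>" using sub by (rule continuous_on_subset)
    have "continuous_on {a..b} F" using F by (rule DERIV_continuous_on)
    then show "continuous_on {s..t} F" using sub by (rule continuous_on_subset)
    fix x assume x: "s < x" "x < t"
    then have at: "at x within {a..b} = at x"
      using st by (intro at_within_interior) auto
    show "(\<gamma> has_vector_derivative \<gamma>' x) (at x)"
      using \<gamma>[of x] x st at by simp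
    show "(F has_vector_derivative norm (\<gamma>' x)) (at x)"
      using F[of x] x st at by (simp add: has_real_derivative_iff_has_vector_derivative)
  qed simp
  then show ?thesis by (simp add: dist_norm norm_minus_commute)
qed simp

text \<open>An antiderivative of the speed takes the place of an integral, because below it is a
  multiple of an area function. Chords are bounded by increments of \<open>F\<close>, which
  telescope. Conversely, uniform continuity of \<open>\<gamma>'\<close> makes both the curve and
  \<open>F\<close> almost linear on the pieces of a fine partition.\<close>

lemma arc_length_eq_diff_of_norm_derivative:
  fixes \<gamma> :: "real \<Rightarrow> 'a::real_normed_vector"
  assumes "a \<le> b"
    and \<gamma>: "\<And>t. t \<in> {a..b} \<Longrightarrow> (\<gamma> has_vector_derivative \<gamma>' t) (at t within {a..b})"
    and cont: "continuous_on {a..b} \<gamma>'"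
    and F: "\<And>t. t \<in> {a..b} \<Longrightarrow> (F has_real_derivative norm (\<gamma>' t)) (at t within {a..b})"
  shows "arc_length \<gamma> a b = ereal (F b - F a)"
proof (rule antisym)
  show "arc_length \<gamma> a b \<le> ereal (F b - F a)"
    unfolding arc_length_def
  proof (rule SUP_least, clarify)
    fix n and t :: "nat \<Rightarrow> real"
    assume t: "a = t 0" "b = t n" "\<forall>i<n. t i \<le> t (Suc i)"
    have "(\<Sum>i<n. dist (\<gamma> (t i)) (\<gamma> (t (Suc i)))) \<le> (\<Sum>i<n. F (t (Suc i)) - F (t i))"
    proof (rule sum_mono)
      fix i assume i: "i \<in> {..<n}"
      show "dist (\<gamma> (t i)) (\<gamma> (t (Suc i))) \<le> F (t (Suc i)) - F (t i)"
        using partition_mono[OF t(3), of 0 i] partition_mono[OF t(3), of "Suc i" n] t i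
        by (intro dist_le_diff_of_norm_derivative[OF \<gamma> F]) auto
    qed
    also have "\<dots> = F (t n) - F (t 0)" by (rule sum_lessThan_telescope)
    finally show "ereal (\<Sum>i<n. dist (\<gamma> (t i)) (\<gamma> (t (Suc i)))) \<le> ereal (F (t n) - F (t 0))"
      by simp
  qed
  show "ereal (F b - F a) \<le> arc_length \<gamma> a b"
  proof (cases "a = b")
    case True
    \<comment> \<open>With \<open>n = 0\<close> the chord sum is empty. The case is separate because
      \<open>e'\<close> below divides by \<open>b - a\<close>.\<close>
    have "ereal 0 \<le> arc_length \<gamma> a b"
      unfolding arc_length_def using True by (intro SUP_upper2[of "(0, \<lambda>_. a)"]) auto
    then show ?thesis using True by simp
  next
    case False
    then have "a < b" using \<open>a \<le> b\<close> by simp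
    show ?thesis
    proof (rule ereal_le_epsilon2)
      fix e :: real assume "e > 0"
      \<comment> \<open>On a piece of width \<open>(b - a) / n\<close> a derivative error of
        \<open>e'\<close> costs \<open>e / (2 * n)\<close>. The curve and \<open>F\<close> each
        incur it once, which adds up to \<open>e\<close> over \<open>n\<close> pieces.\<close>
      define e' where "e' = e / (2 * (b - a))"
      have "e' > 0" using \<open>e > 0\<close> \<open>a < b\<close> by (simp add: e'_def)
      have "uniformly_continuous_on {a..b} \<gamma>'"
        using cont by (intro compact_uniformly_continuous) auto
      then obtain d where "d > 0"
        and d: "\<And>x y. x \<in> {a..b} \<Longrightarrow> y \<in> {a..b} \<Longrightarrow> dist y x < d \<Longrightarrow> dist (\<gamma>' y) (\<gamma>' x) < e'"
        using \<open>e' > 0\<close> unfolding uniformly_continuous_on_def by metis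
      obtain n where n: "(b - a) / d < real n" "n > 0"
        using reals_Archimedean2[of "(b - a) / d"] \<open>0 < d\<close> \<open>a < b\<close>
        by (metis diff_gt_0_iff_gt divide_pos_pos less_trans of_nat_0_less_iff)
      define t where "t i = a + real i * ((b - a) / n)" for i
      have step: "t (Suc i) - t i = (b - a) / n" for i
        unfolding t_def of_nat_Suc distrib_right by simp
      have small: "(b - a) / n < d" "0 < (b - a) / n"
        using n \<open>d > 0\<close> \<open>a < b\<close> by (auto simp: field_simps)
      have t: "t 0 = a" "t n = b" "\<forall>i<n. t i \<le> t (Suc i)"
        using n small step by (auto simp: t_def) (smt (verit) step t_def small)
      have le: "F (t (Suc i)) - F (t i) \<le> dist (\<gamma> (t i)) (\<gamma> (t (Suc i))) + e / n" if "i < n" for i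
      proof -
        let ?S = "{t i..t (Suc i)}"
        have S: "?S \<subseteq> {a..b}"
          using partition_mono[OF t(3), of 0 i] partition_mono[OF t(3), of "Suc i" n] t that by auto
        have i: "t i \<in> ?S" using t(3) that by simp
        have close: "norm (\<gamma>' x - \<gamma>' (t i)) \<le> e'" if "x \<in> ?S" for x
          using d[of "t i" x] S that i step[of i] small by (auto simp: dist_norm)
        \<comment> \<open>The curve is compared with its tangent at the left end of the piece; the
          oscillation of \<open>\<gamma>'\<close> on the piece bounds the error.\<close>
        have "norm (\<gamma> (t (Suc i)) - \<gamma> (t i) - (t (Suc i) - t i) *\<^sub>R \<gamma>' (t i)) \<le> norm (t (Suc i) - t i) * e'"
        proof (rule vector_differentiable_bound_linearization[where S = ?S])
          show "(\<gamma> has_vector_derivative \<gamma>' x) (at x within ?S)" if "x \<in> ?S" for x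
            using \<gamma>[of x] S that has_vector_derivative_within_subset by blast
        qed (use i close in \<open>auto simp: closed_segment_eq_real_ivl\<close>)
        \<comment> \<open>The same for \<open>F\<close>: by the reverse triangle inequality the
          speed oscillates no more than \<open>\<gamma>'\<close>. The linear term of
          \<open>F\<close> is the norm of that of the curve, so only the two errors remain.\<close>
        moreover have "norm (F (t (Suc i)) - F (t i) - (t (Suc i) - t i) *\<^sub>R norm (\<gamma>' (t i))) \<le> norm (t (Suc i) - t i) * e'"
        proof (rule vector_differentiable_bound_linearization[where S = ?S and f' = "\<lambda>x. norm (\<gamma>' x)"])
          show "(F has_vector_derivative norm (\<gamma>' x)) (at x within ?S)" if "x \<in> ?S" for x
            using DERIV_subset[OF F[of x] S] S that
            by (auto simp: has_real_derivative_iff_has_vector_derivative)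
          show "norm (norm (\<gamma>' x) - norm (\<gamma>' (t i))) \<le> e'" if "x \<in> ?S" for x
            using close[OF that] norm_triangle_ineq3[of "\<gamma>' x" "\<gamma>' (t i)"] by simp
        qed (use i in \<open>auto simp: closed_segment_eq_real_ivl\<close>)
        moreover have "norm ((t (Suc i) - t i) *\<^sub>R \<gamma>' (t i)) = (t (Suc i) - t i) *\<^sub>R norm (\<gamma>' (t i))"
          using step[of i] small \<open>a < b\<close> by simp
        moreover have "norm (t (Suc i) - t i) * e' = e / (2 * n)"
        proof -
          have "w / n * (e / (2 * w)) = e / (2 * n)" if "w > 0" for w
            using that by simp
          from this[of "b - a"] show ?thesis
            using \<open>a < b\<close> by (simp only: e'_def step real_norm_def abs_of_pos[OF small(2)] diff_gt_0_iff_gt)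
        qed
        moreover have "e / n = e / (2 * n) + e / (2 * n)" by simp
        moreover have "norm ((t (Suc i) - t i) *\<^sub>R \<gamma>' (t i)) \<le> norm (\<gamma> (t (Suc i)) - \<gamma> (t i))
            + norm (\<gamma> (t (Suc i)) - \<gamma> (t i) - (t (Suc i) - t i) *\<^sub>R \<gamma>' (t i))"
          by (metis norm_triangle_sub norm_minus_commute)
        ultimately show ?thesis
          unfolding dist_norm real_norm_def norm_minus_commute[of "\<gamma> (t i)"] by linarith
      qed
      have "F b - F a = (\<Sum>i<n. F (t (Suc i)) - F (t i))"
        using sum_lessThan_telescope[of "\<lambda>i. F (t i)" n] t by simp
      also have "\<dots> \<le> (\<Sum>i<n. dist (\<gamma> (t i)) (\<gamma> (t (Suc i))) + e / n)"
        using le by (intro sum_mono) auto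
      also have "\<dots> = (\<Sum>i<n. dist (\<gamma> (t i)) (\<gamma> (t (Suc i)))) + e"
        using n by (simp add: sum.distrib)
      finally have "ereal (F b - F a) \<le> ereal (\<Sum>i<n. dist (\<gamma> (t i)) (\<gamma> (t (Suc i)))) + ereal e"
        by simp
      also have "\<dots> \<le> arc_length \<gamma> a b + ereal e"
        unfolding arc_length_def using t
        by (intro add_right_mono SUP_upper2[of "(n, t)"]) auto
      finally show "ereal (F b - F a) \<le> arc_length \<gamma> a b + ereal e" .
    qed
  qed
qed

section \<open>Polar coordinates of points of the lemniscate\<close>

lemma polar_point_eq_rcis: "polar_point r \<theta> = (Re (rcis r \<theta>), Im (rcis r \<theta>))"
  by (simp add: polar_point_def)

lemma polar_point_polar_angle: "polar_point (norm X) (polar_angle X) = X"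
  unfolding polar_point_eq_rcis polar_angle_def
  using rcis_cmod_Arg[of "Complex (fst X) (snd X)"]
  by (simp add: norm_prod_def cmod_def)

lemma polar_angle_polar_point:
  assumes "r > 0" "-pi < \<theta>" "\<theta> \<le> pi"
  shows "polar_angle (polar_point r \<theta>) = \<theta>"
  using assms by (simp add: polar_angle_def polar_point_eq_rcis Arg_rcis del: Re_rcis Im_rcis)

lemma polar_angle_first_quadrant:
  assumes "X \<in> first_quadrant"
  shows "0 \<le> polar_angle X" "polar_angle X \<le> pi / 2"
proof -
  have *: "0 \<le> fst X" "0 \<le> snd X" using assms by (auto simp: first_quadrant_def)
  show "polar_angle X \<le> pi / 2"
    using * Arg_Re_nonneg[of "Complex (fst X) (snd X)"] by (simp add: polar_angle_def)
  \<comment> \<open>Points of the axis, including the origin, have \<open>Arg\<close> equal to 0;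
    \<open>Arg_lt_pi\<close> covers positive imaginary part.\<close>
  show "0 \<le> polar_angle X"
  proof (cases "snd X = 0")
    case True
    then have "polar_angle X = 0"
      using * unfolding polar_angle_def by (simp add: Arg_eq_0 complex_is_Real_iff)
    then show ?thesis by simp
  next
    case False
    then show ?thesis
      using * Arg_lt_pi[of "Complex (fst X) (snd X)"] by (simp add: polar_angle_def)
  qed
qed

text \<open>In polar coordinates the equation reads
  \<open>r ^ 4 = r\<^sup>2 * cos (2 * \<theta>)\<close>. Away from the origin
  \<open>r\<^sup>2\<close> cancels, and \<open>cos (2 * \<theta>)\<close> being nonnegative excludes
  angles beyond \<open>pi / 4\<close>. At the origin the convention \<open>pi / 4\<close> keeps the
  formula true, as \<open>cos (pi / 2) = 0\<close>.\<close>

lemma lemniscate_angle_first_quadrant: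
  assumes "X \<in> lemniscate \<inter> first_quadrant"
  shows "0 \<le> lemniscate_angle X" "lemniscate_angle X \<le> pi / 4"
    and "dist (0, 0) X ^ 2 = cos (2 * lemniscate_angle X)"
proof -
  have "0 \<le> lemniscate_angle X \<and> lemniscate_angle X \<le> pi / 4 \<and>
        norm X ^ 2 = cos (2 * lemniscate_angle X)"
  proof (cases "X = (0, 0)")
    case True
    then show ?thesis by (simp add: lemniscate_angle_def)
  next
    case False
    define \<theta> r where "\<theta> = polar_angle X" and "r = norm X"
    have \<theta>: "0 \<le> \<theta>" "\<theta> \<le> pi / 2"
      using polar_angle_first_quadrant assms by (auto simp: \<theta>_def)
    have "r > 0" using False by (auto simp: r_def zero_prod_def)
    have "X = polar_point r \<theta>" by (simp add: r_def \<theta>_def polar_point_polar_angle)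
    then have *: "((r * cos \<theta>)\<^sup>2 + (r * sin \<theta>)\<^sup>2)\<^sup>2 = (r * cos \<theta>)\<^sup>2 - (r * sin \<theta>)\<^sup>2"
      using assms by (simp add: polar_point_def lemniscate_def)
    have "(r * cos \<theta>)\<^sup>2 + (r * sin \<theta>)\<^sup>2 = r\<^sup>2 * ((sin \<theta>)\<^sup>2 + (cos \<theta>)\<^sup>2)"
      by algebra
    then have sum: "(r * cos \<theta>)\<^sup>2 + (r * sin \<theta>)\<^sup>2 = r\<^sup>2"
      by simp
    have diff: "(r * cos \<theta>)\<^sup>2 - (r * sin \<theta>)\<^sup>2 = r\<^sup>2 * cos (2 * \<theta>)"
      by (simp add: cos_double power_mult_distrib right_diff_distrib)
    have "r\<^sup>2 * r\<^sup>2 = r\<^sup>2 * cos (2 * \<theta>)"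
      using * unfolding sum diff by (simp only: power2_eq_square)
    moreover have "r\<^sup>2 \<noteq> 0" using \<open>r > 0\<close> by simp
    ultimately have r: "r\<^sup>2 = cos (2 * \<theta>)" by (rule mult_left_cancel[THEN iffD1, rotated])
    have "\<theta> \<le> pi / 4"
    proof (rule ccontr)
      assume "\<not> \<theta> \<le> pi / 4"
      then have "cos (2 * \<theta>) < cos (pi / 2)" using \<theta> by (intro cos_monotone_0_pi) auto
      then show False using r zero_le_power2[of r] by simp
    qed
    then show ?thesis
      using \<theta> r False by (simp add: lemniscate_angle_def \<theta>_def r_def)
  qed
  moreover have "dist (0, 0) X = norm X" by (metis dist_0_norm zero_prod_def)
  ultimately show "0 \<le> lemniscate_angle X" "lemniscate_angle X \<le> pi / 4"
    "dist (0, 0) X ^ 2 = cos (2 * lemniscate_angle X)"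
    by auto
qed

section \<open>The angle of D and a smooth parametrization of the lemniscate\<close>

lemma one_plus_square_pos: "0 < 1 + (x::real)\<^sup>2"
  by (smt (verit) zero_le_power2)

text \<open>The quotient is the expression of \<open>cos (2 * \<delta>)\<close> through
  \<open>tan \<delta>\<close>. It determines the square of the tangent, and the signs of sine and
  cosine on the given range settle the root.\<close>

lemma arctan_cos_double_eqI:
  assumes "0 \<le> \<delta>" "\<delta> \<le> pi / 4" "0 \<le> c" "cos (2 * \<delta>) = (1 - c\<^sup>2) / (1 + c\<^sup>2)"
  shows "\<delta> = arctan c"
proof -
  have pos: "cos \<delta> > 0" using assms(1,2) pi_gt_zero by (intro cos_gt_zero_pi; linarith)
  have "1 + c\<^sup>2 \<noteq> 0" using one_plus_square_pos[of c] by simp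
  then have "((cos \<delta>)\<^sup>2 - (sin \<delta>)\<^sup>2) * (1 + c\<^sup>2) = 1 - c\<^sup>2"
    using assms by (simp add: cos_double)
  then have "(cos \<delta>)\<^sup>2 * (1 + c\<^sup>2) = 1"
    by (simp add: sin_squared_eq algebra_simps)
  then have "(sin \<delta>)\<^sup>2 = (c * cos \<delta>)\<^sup>2"
    by (simp add: sin_squared_eq algebra_simps)
  moreover have "sin \<delta> \<ge> 0" using assms(1,2) pi_gt_zero by (intro sin_ge_zero; linarith)
  moreover have "c * cos \<delta> \<ge> 0" using assms(3) pos by simp
  ultimately have "sin \<delta> = c * cos \<delta>" by (rule power2_eq_imp_eq)
  then have "tan \<delta> = c" using pos by (simp add: tan_def)
  then show ?thesis using assms(1,2) arctan_tan[of \<delta>] pi_gt_zero by simp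
qed

text \<open>With tangent \<open>s = sin (2 * u)\<close>, the radicand
  \<open>cos (2 * \<theta>)\<close> becomes \<open>(1 - s\<^sup>2) / (1 + s\<^sup>2)\<close>, whose
  numerator is the square of \<open>cos (2 * u)\<close>. The root thus disappears, and with it the
  singularity at the origin; the range of \<open>u\<close> makes \<open>cos (2 * u)\<close>
  nonnegative.\<close>

lemma lemniscate_curve_arctan_sin:
  assumes "0 \<le> u" "u \<le> pi / 4"
  shows "lemniscate_curve (arctan (sin (2 * u))) =
    (cos (2 * u) / (1 + (sin (2 * u))\<^sup>2), sin (2 * u) * cos (2 * u) / (1 + (sin (2 * u))\<^sup>2))"
proof -
  define s c where "s = sin (2 * u)" and "c = cos (2 * u)"
  have "c \<ge> 0" unfolding c_def using assms by (intro cos_ge_zero) auto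
  have sc: "1 - s\<^sup>2 = c\<^sup>2" by (simp add: s_def c_def cos_squared_eq)
  have pos: "0 < 1 + s\<^sup>2" by (rule one_plus_square_pos)
  have "cos (2 * arctan s) = c\<^sup>2 / (1 + s\<^sup>2)"
    using pos sc by (simp add: cos_double cos_arctan sin_arctan power_divide flip: diff_divide_distrib)
  then have "sqrt (cos (2 * arctan s)) = c / sqrt (1 + s\<^sup>2)"
    using \<open>c \<ge> 0\<close> by (simp add: real_sqrt_divide)
  then have "lemniscate_curve (arctan s) = (c / (1 + s\<^sup>2), s * c / (1 + s\<^sup>2))"
    using pos by (simp add: lemniscate_curve_def polar_point_def cos_arctan sin_arctan mult.commute)
  then show ?thesis by (simp add: s_def c_def)
qed

lemma lemniscate_parametrization:
  defines "\<gamma> \<equiv> \<lambda>u::real. (cos (2 * u) / (1 + (sin (2 * u))\<^sup>2), sin (2 * u) * cos (2 * u) / (1 + (sin (2 * u))\<^sup>2))"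
    and "\<gamma>' \<equiv> \<lambda>u::real. (- 2 * sin (2 * u) * (3 - (sin (2 * u))\<^sup>2) / (1 + (sin (2 * u))\<^sup>2)\<^sup>2,
                  2 * (1 - 3 * (sin (2 * u))\<^sup>2) / (1 + (sin (2 * u))\<^sup>2)\<^sup>2)"
  shows "(\<gamma> has_vector_derivative \<gamma>' u) (at u within S)"
    and "norm (\<gamma>' u) = 2 / sqrt (1 + (sin (2 * u))\<^sup>2)"
    and "continuous_on S \<gamma>'"
proof -
  have nz: "1 + (sin (2 * u))\<^sup>2 \<noteq> 0" for u :: real using one_plus_square_pos[of "sin (2*u)"] by simp
  define s c where "s = sin (2 * u)" and "c = cos (2 * u)"
  have sc: "c\<^sup>2 = 1 - s\<^sup>2" by (simp add: s_def c_def cos_squared_eq)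
  have pos: "0 < 1 + s\<^sup>2" by (rule one_plus_square_pos)
  show "(\<gamma> has_vector_derivative \<gamma>' u) (at u within S)"
    unfolding \<gamma>_def \<gamma>'_def
  proof (intro has_vector_derivative_Pair; unfold has_real_derivative_iff_has_vector_derivative[symmetric])
    have "- 2 * s * (1 + s\<^sup>2) - c * (4 * s * c) = - 2 * s * (3 - s\<^sup>2)"
      using sc by algebra
    then show "((\<lambda>u. cos (2 * u) / (1 + (sin (2 * u))\<^sup>2)) has_real_derivative
        - 2 * sin (2 * u) * (3 - (sin (2 * u))\<^sup>2) / (1 + (sin (2 * u))\<^sup>2)\<^sup>2) (at u within S)"
      using nz by (auto intro!: derivative_eq_intros simp: power2_eq_square s_def c_def mult_ac)
    have "(2 * c * c - 2 * s * s) * (1 + s\<^sup>2) - s * c * (4 * s * c) = 2 * (1 - 3 * s\<^sup>2)"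
      using sc by algebra
    then show "((\<lambda>u. sin (2 * u) * cos (2 * u) / (1 + (sin (2 * u))\<^sup>2)) has_real_derivative
        2 * (1 - 3 * (sin (2 * u))\<^sup>2) / (1 + (sin (2 * u))\<^sup>2)\<^sup>2) (at u within S)"
      using nz by (auto intro!: derivative_eq_intros simp: power2_eq_square s_def c_def mult_ac)
  qed
  have "(- 2 * s * (3 - s\<^sup>2) / (1 + s\<^sup>2)\<^sup>2)\<^sup>2 + (2 * (1 - 3 * s\<^sup>2) / (1 + s\<^sup>2)\<^sup>2)\<^sup>2
      = ((- 2 * s * (3 - s\<^sup>2))\<^sup>2 + (2 * (1 - 3 * s\<^sup>2))\<^sup>2) / ((1 + s\<^sup>2)\<^sup>2)\<^sup>2"
    by (simp add: power_divide add_divide_distrib)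
  \<comment> \<open>Up to sign and the factor 2, the two numerators are the imaginary and real parts
    of \<open>(1 + \<i> * s) ^ 3\<close>, whose squared modulus is
    \<open>(1 + s\<^sup>2) ^ 3\<close>.\<close>
  also have "(- 2 * s * (3 - s\<^sup>2))\<^sup>2 + (2 * (1 - 3 * s\<^sup>2))\<^sup>2 = 4 * (1 + s\<^sup>2) ^ 3"
    by algebra
  also have "4 * (1 + s\<^sup>2) ^ 3 / ((1 + s\<^sup>2)\<^sup>2)\<^sup>2 = 4 / (1 + s\<^sup>2)"
    using pos by (simp add: power2_eq_square power3_eq_cube)
  finally have "sqrt ((- 2 * s * (3 - s\<^sup>2) / (1 + s\<^sup>2)\<^sup>2)\<^sup>2 + (2 * (1 - 3 * s\<^sup>2) / (1 + s\<^sup>2)\<^sup>2)\<^sup>2)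
      = 2 / sqrt (1 + s\<^sup>2)"
    by (simp only: real_sqrt_divide real_sqrt_four)
  then show "norm (\<gamma>' u) = 2 / sqrt (1 + (sin (2 * u))\<^sup>2)"
    by (simp only: \<gamma>'_def norm_prod_def fst_conv snd_conv real_norm_def power2_abs s_def)
  show "continuous_on S \<gamma>'"
    unfolding \<gamma>'_def using nz by (intro continuous_intros) auto
qed

section \<open>Area of a plane region by horizontal slices\<close>

lemma measure_region_between_graphs:
  fixes f g :: "real \<Rightarrow> real" and c d :: real
  defines "R \<equiv> {(x, y). c \<le> y \<and> y \<le> d \<and> g y \<le> x \<and> x \<le> f y}"
  assumes R: "R \<in> sets borel"
    and le: "\<And>y. c \<le> y \<Longrightarrow> y \<le> d \<Longrightarrow> g y \<le> f y"
    and I: "((\<lambda>y. f y - g y) has_integral I) {c..d}"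
  shows "measure lebesgue R = I"
proof -
  have "0 \<le> I" using le by (intro has_integral_nonneg[OF I]) auto
  have "emeasure lborel R = emeasure (lborel \<Otimes>\<^sub>M lborel) R"
    by (simp add: lborel_prod borel_prod)
  \<comment> \<open>Tonelli's theorem with the second coordinate fixed: each slice is a horizontal
    segment or empty.\<close>
  also have "\<dots> = (\<integral>\<^sup>+y. emeasure lborel ((\<lambda>x. (x, y)) -` R) \<partial>lborel)"
    using R by (intro lborel_pair.emeasure_pair_measure_alt2) (simp only: lborel_prod sets_lborel)
  also have "\<dots> = (\<integral>\<^sup>+y. ennreal (f y - g y) * indicator {c..d} y \<partial>lborel)"
  proof (rule nn_integral_cong)
    fix y
    have "(\<lambda>x. (x, y)) -` R = (if y \<in> {c..d} then {g y..f y} else {})"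
      by (auto simp: R_def)
    then show "emeasure lborel ((\<lambda>x. (x, y)) -` R) = ennreal (f y - g y) * indicator {c..d} y"
      using le by (auto simp: indicator_def)
  qed
  also have "\<dots> = ennreal I"
    using le by (intro nn_integral_has_integral_lebesgue' I) auto
  finally have "measure lborel R = I"
    using \<open>0 \<le> I\<close> by (simp add: measure_def)
  then show ?thesis using R by simp
qed

section \<open>The squircle in polar coordinates and the area of its sector\<close>

definition squircle_radius :: "real \<Rightarrow> real" where
  "squircle_radius \<theta> = ((cos \<theta>) ^ 4 + (sin \<theta>) ^ 4) powr (- 1 / 4)"

text \<open>The identity \<open>2 * (p\<^sup>2 + q\<^sup>2) = (p + q)\<^sup>2 + (p -
  q)\<^sup>2\<close> at the squares of cosine and sine. The double angle is what links the squircle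
  to the speed on the lemniscate.\<close>

lemma cos4_plus_sin4: "(cos \<theta>) ^ 4 + (sin \<theta>) ^ 4 = (1 + (cos (2 * \<theta>))\<^sup>2) / (2::real)"
proof -
  have "(sin \<theta>)\<^sup>2 + (cos \<theta>)\<^sup>2 = 1" by simp
  then have "2 * ((cos \<theta>) ^ 4 + (sin \<theta>) ^ 4) = 1 + ((cos \<theta>)\<^sup>2 - (sin \<theta>)\<^sup>2)\<^sup>2" by algebra
  then show ?thesis by (simp add: cos_double)
qed

lemma cos4_plus_sin4_pos: "0 < (cos \<theta>) ^ 4 + (sin (\<theta>::real)) ^ 4"
  using one_plus_square_pos[of "cos (2 * \<theta>)"] by (simp add: cos4_plus_sin4)

lemma squircle_radius_pos: "0 < squircle_radius \<theta>"
  using cos4_plus_sin4_pos[of \<theta>] by (simp add: squircle_radius_def)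

lemma squircle_radius_power2: "(squircle_radius \<theta>)\<^sup>2 = sqrt 2 / sqrt (1 + (cos (2 * \<theta>))\<^sup>2)"
proof -
  have "(squircle_radius \<theta>)\<^sup>2 = ((cos \<theta>) ^ 4 + (sin \<theta>) ^ 4) powr (- (1 / 2))"
    using cos4_plus_sin4_pos[of \<theta>] by (simp add: squircle_radius_def powr_power)
  also have "\<dots> = 1 / sqrt ((cos \<theta>) ^ 4 + (sin \<theta>) ^ 4)"
    using cos4_plus_sin4_pos[of \<theta>] by (simp add: powr_minus_divide powr_half_sqrt)
  finally show ?thesis by (simp add: cos4_plus_sin4 real_sqrt_divide)
qed

text \<open>This is \<open>x ^ 4 + y ^ 4 = 1\<close> at the point with polar coordinates
  \<open>squircle_radius \<theta>\<close> and \<open>\<theta>\<close>.\<close>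

lemma squircle_radius_power4: "(squircle_radius \<theta>) ^ 4 * ((cos \<theta>) ^ 4 + (sin \<theta>) ^ 4) = 1"
proof -
  have "(squircle_radius \<theta>) ^ 4 = ((squircle_radius \<theta>)\<^sup>2)\<^sup>2" by simp
  also have "\<dots> = 2 / (1 + (cos (2 * \<theta>))\<^sup>2)"
    unfolding squircle_radius_power2 using one_plus_square_pos[of "cos (2 * \<theta>)"] by (simp add: power_divide)
  finally show ?thesis using one_plus_square_pos[of "cos (2 * \<theta>)"] by (simp add: cos4_plus_sin4)
qed

lemma squircle_radius_unique:
  assumes "t \<ge> 0" "polar_point t \<theta> \<in> squircle"
  shows "t = squircle_radius \<theta>"
proof -
  have "t ^ 4 * ((cos \<theta>) ^ 4 + (sin \<theta>) ^ 4) = 1"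
    using assms by (simp add: polar_point_def squircle_def power_mult_distrib distrib_left)
  then have "t ^ 4 = (squircle_radius \<theta>) ^ 4"
    using squircle_radius_power4[of \<theta>] cos4_plus_sin4_pos[of \<theta>] by (metis less_irrefl mult_right_cancel)
  then show ?thesis
    using assms squircle_radius_pos[of \<theta>] by (auto intro: power_eq_imp_eq_base)
qed

text \<open>The value of the derivative stays hidden because it cancels in the derivative of the
  sector area.\<close>

lemma squircle_radius_has_real_derivative:
  obtains d where "(squircle_radius has_real_derivative d) (at \<theta>)"
proof
  show "(squircle_radius has_real_derivative
    (- 1 / 4) * ((cos \<theta>) ^ 4 + (sin \<theta>) ^ 4) powr (- 1 / 4 - 1)
      * (- 4 * (cos \<theta>) ^ 3 * sin \<theta> + 4 * (sin \<theta>) ^ 3 * cos \<theta>)) (at \<theta>)"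
    unfolding squircle_radius_def[abs_def] using cos4_plus_sin4_pos[of \<theta>]
    by (auto intro!: derivative_eq_intros simp: powr_diff)
qed

text \<open>For \<open>r > 0\<close> and angles in the first quadrant,
  \<open>\<theta> \<le> \<alpha>\<close> is equivalent to
  \<open>r * sin (\<alpha> - \<theta>)\<close> being nonnegative, and the addition formula turns
  this into the linear inequality for the half-plane below the ray.\<close>

lemma squircular_sector_eq:
  assumes "0 \<le> \<alpha>" "\<alpha> \<le> pi / 4" "polar_angle B' = \<alpha>"
  shows "squircular_sector B' =
    {(x, y). 0 \<le> x \<and> 0 \<le> y \<and> y * cos \<alpha> \<le> x * sin \<alpha> \<and> x ^ 4 + y ^ 4 \<le> 1}"
proof -
  have "(\<exists>r \<theta>. (x, y) = polar_point r \<theta> \<and> 0 \<le> r \<and> 0 \<le> \<theta> \<and> \<theta> \<le> \<alpha>) \<longleftrightarrow>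
     0 \<le> x \<and> 0 \<le> y \<and> y * cos \<alpha> \<le> x * sin \<alpha>" for x y
  proof safe
    fix r \<theta> assume xy: "(x, y) = polar_point r \<theta>" and *: "0 \<le> r" "0 \<le> \<theta>" "\<theta> \<le> \<alpha>"
    show "0 \<le> x" "0 \<le> y"
      using xy * assms pi_gt_zero by (auto simp: polar_point_def intro!: mult_nonneg_nonneg cos_ge_zero sin_ge_zero)
    have "0 \<le> r * sin (\<alpha> - \<theta>)"
      using * assms pi_gt_zero by (intro mult_nonneg_nonneg sin_ge_zero) auto
    then show "y * cos \<alpha> \<le> x * sin \<alpha>"
      using xy by (simp add: polar_point_def sin_diff algebra_simps)
  next
    assume *: "0 \<le> x" "0 \<le> y" "y * cos \<alpha> \<le> x * sin \<alpha>"
    define r \<theta> where "r = norm (x, y)" and "\<theta> = polar_angle (x, y)"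
    have xy: "(x, y) = polar_point r \<theta>"
      by (simp add: r_def \<theta>_def polar_point_polar_angle)
    have \<theta>: "0 \<le> \<theta>" "\<theta> \<le> pi / 2"
      using * polar_angle_first_quadrant[of "(x, y)"] by (auto simp: \<theta>_def first_quadrant_def)
    show "\<exists>r \<theta>. (x, y) = polar_point r \<theta> \<and> 0 \<le> r \<and> 0 \<le> \<theta> \<and> \<theta> \<le> \<alpha>"
    proof (cases "r = 0")
      case True
      then have "(x, y) = polar_point 0 0" using xy by (simp add: polar_point_def)
      then show ?thesis using assms by blast
    next
      case False
      then have "r > 0" by (simp add: r_def)
      have "r * sin (\<alpha> - \<theta>) \<ge> 0"
        using xy * by (simp add: polar_point_def sin_diff algebra_simps)
      then have "sin (\<alpha> - \<theta>) \<ge> 0" using \<open>r > 0\<close> by (simp add: zero_le_mult_iff)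
      then have "\<not> \<alpha> < \<theta>"
        using sin_gt_zero[of "\<theta> - \<alpha>"] \<theta> assms pi_gt_zero sin_minus[of "\<alpha> - \<theta>"] by auto
      then show ?thesis using xy \<open>r > 0\<close> \<theta> by (intro exI[of _ r] exI[of _ \<theta>]) auto
    qed
  qed
  then show ?thesis
    unfolding squircular_sector_def assms(3) by auto
qed

text \<open>The polar area formula in differential form, which is all that the comparison with the
  length needs. The area is first found by horizontal slices as a function of the angle and then
  differentiated.\<close>

lemma squircular_sector_area:
  obtains A where
    "\<forall>\<theta>\<in>{0..pi / 4}. (A has_real_derivative (squircle_radius \<theta>)\<^sup>2 / 2) (at \<theta>)"
    "\<forall>B'. polar_angle B' \<in> {0..pi / 4} \<longrightarrow>
       measure lebesgue (squircular_sector B') = A (polar_angle B')"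
    "A 0 = 0"
proof -
  define f where "f y = root 4 (1 - y ^ 4)" for y :: real
  define X Y where "X \<theta> = squircle_radius \<theta> * cos \<theta>" and "Y \<theta> = squircle_radius \<theta> * sin \<theta>" for \<theta>
  \<comment> \<open>The interval extends below 0 so that \<open>Y 0 = 0\<close> is an interior point
    and \<open>H\<close> has a two-sided derivative there.\<close>
  have "continuous_on {-1..1} f" unfolding f_def by (intro continuous_intros)
  then obtain H where H: "\<And>y. y \<in> {-1..1} \<Longrightarrow> (H has_vector_derivative f y) (at y within {-1..1})"
    using antiderivative_continuous by blast
  have XY4: "X \<theta> ^ 4 + Y \<theta> ^ 4 = 1" for \<theta>
    using squircle_radius_power4[of \<theta>] by (simp add: X_def Y_def power_mult_distrib distrib_left)
  have X_pos: "X \<theta> > 0" and Y_nonneg: "Y \<theta> \<ge> 0" if "0 \<le> \<theta>" "\<theta> \<le> pi / 4" for \<theta>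
  proof -
    have "cos \<theta> > 0" using that pi_gt_zero by (intro cos_gt_zero_pi; linarith)
    moreover have "sin \<theta> \<ge> 0" using that pi_gt_zero by (intro sin_ge_zero; linarith)
    ultimately show "X \<theta> > 0" "Y \<theta> \<ge> 0"
      using squircle_radius_pos[of \<theta>] by (auto simp: X_def Y_def)
  qed
  have Y_less_1: "Y \<theta> < 1" if "0 \<le> \<theta>" "\<theta> \<le> pi / 4" for \<theta>
  proof -
    have "Y \<theta> ^ 4 < 1 ^ 4" using XY4[of \<theta>] zero_less_power[OF X_pos[OF that], of 4]
      unfolding power_one by linarith
    then show ?thesis by (rule power_less_imp_less_base) simp
  qed
  have fY: "f (Y \<theta>) = X \<theta>" if "0 \<le> \<theta>" "\<theta> \<le> pi / 4" for \<theta>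
    using XY4[of \<theta>] X_pos[OF that] unfolding f_def
    by (smt (verit) real_root_pos2 zero_less_numeral)
  \<comment> \<open>\<open>H (Y \<theta>) - H 0\<close> is the area between the vertical axis and
    the squircle up to height \<open>Y \<theta>\<close>. The triangle between the axis and the ray,
    with legs \<open>X \<theta>\<close> and \<open>Y \<theta>\<close>, is removed.\<close>
  define A where "A \<theta> = H (Y \<theta>) - H 0 - X \<theta> * Y \<theta> / 2" for \<theta>
  show ?thesis
  proof (rule that; (intro ballI allI impI)?)
    show "A 0 = 0" by (simp add: A_def Y_def)
  next
    fix \<alpha> :: real assume "\<alpha> \<in> {0..pi / 4}"
    then have \<alpha>: "0 \<le> \<alpha>" "\<alpha> \<le> pi / 4" by auto
    obtain d where d: "(squircle_radius has_real_derivative d) (at \<alpha>)"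
      by (rule squircle_radius_has_real_derivative)
    let ?r = "squircle_radius \<alpha>"
    have X': "(X has_real_derivative d * cos \<alpha> - ?r * sin \<alpha>) (at \<alpha>)"
      unfolding X_def[abs_def] by (auto intro!: derivative_eq_intros d)
    have Y': "(Y has_real_derivative d * sin \<alpha> + ?r * cos \<alpha>) (at \<alpha>)"
      unfolding Y_def[abs_def] by (auto intro!: derivative_eq_intros d)
    have "at (Y \<alpha>) within {-1..1} = at (Y \<alpha>)"
      using Y_nonneg[OF \<alpha>] Y_less_1[OF \<alpha>] by (intro at_within_interior) auto
    then have "(H has_real_derivative X \<alpha>) (at (Y \<alpha>))"
      using H[of "Y \<alpha>"] Y_nonneg[OF \<alpha>] Y_less_1[OF \<alpha>] fY[OF \<alpha>]
      by (simp add: has_real_derivative_iff_has_vector_derivative)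
    then have HY: "((\<lambda>\<theta>. H (Y \<theta>)) has_real_derivative X \<alpha> * (d * sin \<alpha> + ?r * cos \<alpha>)) (at \<alpha>)"
      using Y' by (rule DERIV_chain2)
    \<comment> \<open>All terms with \<open>d\<close> cancel, and the rest is collected by the
      Pythagorean identity.\<close>
    have "X \<alpha> * (d * sin \<alpha> + ?r * cos \<alpha>)
        - ((d * cos \<alpha> - ?r * sin \<alpha>) * Y \<alpha> + (d * sin \<alpha> + ?r * cos \<alpha>) * X \<alpha>) / 2
      = ?r\<^sup>2 * ((sin \<alpha>)\<^sup>2 + (cos \<alpha>)\<^sup>2) / 2"
      unfolding X_def Y_def
      by (simp add: field_simps power2_eq_square del: sin_cos_squared_add sin_cos_squared_add3)
    then have "X \<alpha> * (d * sin \<alpha> + ?r * cos \<alpha>)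
        - ((d * cos \<alpha> - ?r * sin \<alpha>) * Y \<alpha> + (d * sin \<alpha> + ?r * cos \<alpha>) * X \<alpha>) / 2 = ?r\<^sup>2 / 2"
      by simp
    moreover have "(A has_real_derivative X \<alpha> * (d * sin \<alpha> + ?r * cos \<alpha>) - 0
        - ((d * cos \<alpha> - ?r * sin \<alpha>) * Y \<alpha> + (d * sin \<alpha> + ?r * cos \<alpha>) * X \<alpha>) / 2) (at \<alpha>)"
      unfolding A_def[abs_def] by (intro DERIV_diff DERIV_cdivide DERIV_mult DERIV_const HY X' Y')
    ultimately show "(A has_real_derivative ?r\<^sup>2 / 2) (at \<alpha>)"
      by (simp only: diff_0_right)
  next
    fix B' :: "real \<times> real" assume B'_angle: "polar_angle B' \<in> {0..pi / 4}"
    define \<alpha> where "\<alpha> = polar_angle B'"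
    have \<alpha>: "0 \<le> \<alpha>" "\<alpha> \<le> pi / 4" using B'_angle by (auto simp: \<alpha>_def)
    \<comment> \<open>The ray bounds the horizontal slices on the left and the squircle on the
      right. For \<open>\<alpha> = 0\<close> division by zero gives \<open>g y = 0\<close>, and the
      region correctly degenerates to a segment, since \<open>Y 0 = 0\<close>.\<close>
    define g where "g y = y * (cos \<alpha> / sin \<alpha>)" for y
    let ?R = "{(x, y). 0 \<le> y \<and> y \<le> Y \<alpha> \<and> g y \<le> x \<and> x \<le> f y}"
    \<comment> \<open>\<open>root 4\<close> is increasing on all reals, with negative values at
      negative arguments, so this also covers \<open>y ^ 4 > 1\<close>.\<close>
    have f_iff: "x ^ 4 + y ^ 4 \<le> 1 \<longleftrightarrow> x \<le> f y" if "0 \<le> x" for x y :: real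
    proof -
      have "x ^ 4 + y ^ 4 \<le> 1 \<longleftrightarrow> root 4 (x ^ 4) \<le> root 4 (1 - y ^ 4)"
        by (subst real_root_le_iff) auto
      then show ?thesis using that by (simp add: f_def real_root_power_cancel)
    qed
    \<comment> \<open>The abscissa \<open>X \<alpha>\<close> of the corner where ray and squircle
      meet separates the two graphs.\<close>
    have le: "g y \<le> f y" if "0 \<le> y" "y \<le> Y \<alpha>" for y
    proof -
      have "g y \<le> X \<alpha>"
      proof (cases "\<alpha> = 0")
        case True
        then show ?thesis using X_pos[OF \<alpha>] by (simp add: g_def)
      next
        case False
        then have "sin \<alpha> > 0" using \<alpha> pi_gt_zero by (intro sin_gt_zero; linarith)
        moreover have "cos \<alpha> > 0" using \<alpha> pi_gt_zero by (intro cos_gt_zero_pi; linarith)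
        ultimately have "g y \<le> Y \<alpha> * (cos \<alpha> / sin \<alpha>)"
          unfolding g_def using that by (intro mult_right_mono) auto
        also have "\<dots> = X \<alpha>" using \<open>sin \<alpha> > 0\<close> by (simp add: X_def Y_def)
        finally show ?thesis .
      qed
      also have "X \<alpha> \<le> f y"
        unfolding f_iff[OF less_imp_le[OF X_pos[OF \<alpha>]], symmetric]
        using XY4[of \<alpha>] power_mono[OF that(2,1), of 4] by simp
      finally show ?thesis .
    qed
    have eq: "squircular_sector B' = ?R"
    proof -
      have "0 \<le> x \<and> 0 \<le> y \<and> y * cos \<alpha> \<le> x * sin \<alpha> \<and> x ^ 4 + y ^ 4 \<le> 1 \<longleftrightarrow>
        0 \<le> y \<and> y \<le> Y \<alpha> \<and> g y \<le> x \<and> x \<le> f y" for x y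
      proof (cases "\<alpha> = 0")
        case True
        then show ?thesis using f_iff[of x y] by (auto simp: Y_def g_def)
      next
        case False
        then have s: "sin \<alpha> > 0" using \<alpha> pi_gt_zero by (intro sin_gt_zero; linarith)
        have c: "cos \<alpha> > 0" using \<alpha> pi_gt_zero by (intro cos_gt_zero_pi; linarith)
        have 1: "y * cos \<alpha> \<le> x * sin \<alpha> \<longleftrightarrow> g y \<le> x"
          using s by (simp add: g_def field_simps)
        have 2: "0 \<le> x" if "0 \<le> y" "g y \<le> x"
          using that s c by (smt (verit) g_def divide_pos_pos mult_nonneg_nonneg)
        \<comment> \<open>A point above the corner and to the right of the ray exceeds the corner in
          both coordinates, so it lies outside the squircle.\<close>
        have 3: "y \<le> Y \<alpha>" if "g y \<le> x" "x ^ 4 + y ^ 4 \<le> 1"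
        proof (rule ccontr)
          assume y: "\<not> y \<le> Y \<alpha>"
          have "X \<alpha> = g (Y \<alpha>)" using s by (simp add: g_def X_def Y_def)
          also have "\<dots> < g y" unfolding g_def using y s c by (intro mult_strict_right_mono) auto
          also have "\<dots> \<le> x" by fact
          finally have "X \<alpha> ^ 4 < x ^ 4" using X_pos[OF \<alpha>] by (intro power_strict_mono) auto
          moreover have "Y \<alpha> ^ 4 < y ^ 4" using Y_nonneg[OF \<alpha>] y by (intro power_strict_mono) auto
          ultimately show False using XY4[of \<alpha>] that by simp
        qed
        show ?thesis using 1 2 3 f_iff by blast
      qed
      then show ?thesis unfolding squircular_sector_eq[OF \<alpha> \<alpha>_def[symmetric]] by auto
    qed
    have "closed {z::real\<times>real. 0 \<le> snd z \<and> snd z \<le> Y \<alpha> \<and> g (snd z) \<le> fst z \<and> fst z \<le> f (snd z)}"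
      unfolding f_def g_def divide_inverse
      by (intro closed_Collect_conj closed_Collect_le continuous_intros)
    then have "?R \<in> sets borel" by (simp add: case_prod_unfold)
    moreover have "((\<lambda>y. f y - g y) has_integral A \<alpha>) {0..Y \<alpha>}"
    proof -
      let ?G = "\<lambda>y. H y - y\<^sup>2 / 2 * (cos \<alpha> / sin \<alpha>)"
      have "((\<lambda>y. f y - g y) has_integral ?G (Y \<alpha>) - ?G 0) {0..Y \<alpha>}"
      proof (rule fundamental_theorem_of_calculus)
        show "0 \<le> Y \<alpha>" by (rule Y_nonneg[OF \<alpha>])
        fix y assume y: "y \<in> {0..Y \<alpha>}"
        have "(H has_vector_derivative f y) (at y within {0..Y \<alpha>})"
          using y Y_less_1[OF \<alpha>] by (intro has_vector_derivative_within_subset[OF H]) auto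
        then have "(H has_real_derivative f y) (at y within {0..Y \<alpha>})"
          by (simp add: has_real_derivative_iff_has_vector_derivative)
        then have "(?G has_real_derivative f y - g y) (at y within {0..Y \<alpha>})"
          unfolding g_def divide_inverse by (auto intro!: derivative_eq_intros)
        then show "(?G has_vector_derivative f y - g y) (at y within {0..Y \<alpha>})"
          by (simp add: has_real_derivative_iff_has_vector_derivative)
      qed
      \<comment> \<open>If \<open>sin \<alpha>\<close> is nonzero then
        \<open>Y \<alpha> * (cos \<alpha> / sin \<alpha>) = X \<alpha>\<close>; otherwise
        \<open>Y \<alpha> = 0\<close> and both sides vanish.\<close>
      moreover have "?G (Y \<alpha>) - ?G 0 = A \<alpha>"
        by (cases "sin \<alpha> = 0") (auto simp: A_def X_def Y_def power2_eq_square)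
      ultimately show ?thesis by (simp only:)
    qed
    ultimately show "measure lebesgue (squircular_sector B') = A (polar_angle B')"
      unfolding eq \<alpha>_def[symmetric] using le by (intro measure_region_between_graphs) auto
  qed
qed

section \<open>Comparison of the length with the area\<close>

theorem theorem10:
  fixes B B' D :: "real \<times> real" and l :: ereal and a :: real
  assumes "B \<in> lemniscate \<inter> first_quadrant"
    and "radial_projection B B'"
    and "D \<in> lemniscate \<inter> first_quadrant"
    and "(dist (0, 0) D)\<^sup>2 = (1 - dist (0, 0) B ^ 4) / (1 + dist (0, 0) B ^ 4)"
    and "l = arc_length lemniscate_curve (lemniscate_angle D) (pi / 4)"
    and "a = measure lebesgue (squircular_sector B')"
  shows "l = ereal (2 * a * sqrt 2)"
proof -
  define \<alpha> where "\<alpha> = lemniscate_angle B"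
  note B = lemniscate_angle_first_quadrant[OF assms(1), folded \<alpha>_def]
  note D = lemniscate_angle_first_quadrant[OF assms(3)]
  have "dist (0, 0) B ^ 4 = (dist (0, 0) B ^ 2)\<^sup>2" by simp
  then have B4: "dist (0, 0) B ^ 4 = (cos (2 * \<alpha>))\<^sup>2" unfolding B(3) .
  have "cos (2 * \<alpha>) \<ge> 0" using zero_le_power2 B(3) by metis
  then have angle_D: "lemniscate_angle D = arctan (cos (2 * \<alpha>))"
    using D assms(4) unfolding B4 by (intro arctan_cos_double_eqI) auto
  obtain t where t: "B' \<in> squircle" "t \<ge> 0" "B' = polar_point t \<alpha>"
    using assms(2) by (auto simp: radial_projection_def \<alpha>_def)
  \<comment> \<open>A positive radius is needed to read off the angle of \<open>B'\<close>.\<close>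
  then have "t > 0" using squircle_radius_unique squircle_radius_pos by metis
  then have angle_B': "polar_angle B' = \<alpha>"
    unfolding t(3) using B(1,2) pi_gt_zero by (intro polar_angle_polar_point; linarith)
  obtain A where
    A': "\<forall>\<theta>\<in>{0..pi / 4}. (A has_real_derivative (squircle_radius \<theta>)\<^sup>2 / 2) (at \<theta>)"
    and area: "\<forall>B'. polar_angle B' \<in> {0..pi / 4} \<longrightarrow>
       measure lebesgue (squircular_sector B') = A (polar_angle B')"
    and A: "A 0 = 0"
    by (rule squircular_sector_area)
  have a: "a = A \<alpha>" using area[rule_format, of B'] angle_B' B(1,2) assms(6) by simp
  \<comment> \<open>The parameter of \<open>D\<close>, as
    \<open>sin (2 * u\<^sub>0) = cos (2 * \<alpha>)\<close>. The arc is traversed from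
    \<open>D\<close> to the origin, which lies at \<open>u = pi / 4\<close>.\<close>
  define u\<^sub>0 where "u\<^sub>0 = pi / 4 - \<alpha>"
  have u\<^sub>0: "0 \<le> u\<^sub>0" "u\<^sub>0 \<le> pi / 4" using B(1,2) by (auto simp: u\<^sub>0_def)
  define h where "h u = arctan (sin (2 * u))" for u :: real
  \<comment> \<open>The area function rescaled to an antiderivative of the speed; the minus sign is
    there because the sector angle \<open>pi / 4 - u\<close> decreases in \<open>u\<close>.\<close>
  define F where "F u = - 2 * sqrt 2 * A (pi / 4 - u)" for u
  have "2 * u\<^sub>0 = pi / 2 - 2 * \<alpha>" by (simp add: u\<^sub>0_def)
  then have "h u\<^sub>0 = lemniscate_angle D" "h (pi / 4) = pi / 4"
    by (simp_all add: h_def angle_D sin_diff arctan_one)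
  then have "l = arc_length lemniscate_curve (h u\<^sub>0) (h (pi / 4))"
    using assms(5) by (simp only:)
  also have "\<dots> = arc_length (lemniscate_curve \<circ> h) u\<^sub>0 (pi / 4)"
  proof (rule arc_length_reparametrization[OF u\<^sub>0(2)])
    show "continuous_on {u\<^sub>0..pi / 4} h" unfolding h_def by (intro continuous_intros)
    show "strict_mono_on {u\<^sub>0..pi / 4} h"
    proof (rule strict_mono_onI)
      fix u v assume "u \<in> {u\<^sub>0..pi / 4}" "v \<in> {u\<^sub>0..pi / 4}" "u < v"
      then have "sin (2 * u) < sin (2 * v)"
        using u\<^sub>0 pi_gt_zero unfolding atLeastAtMost_iff by (intro sin_monotone_2pi; linarith)
      then show "h u < h v" by (simp add: h_def arctan_less_iff)
    qed
  qed
  also have "\<dots> = ereal (F (pi / 4) - F u\<^sub>0)"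
  proof (rule arc_length_eq_diff_of_norm_derivative[OF u\<^sub>0(2)])
    fix u assume u: "u \<in> {u\<^sub>0..pi / 4}"
    \<comment> \<open>The derivative is taken within the interval: beyond \<open>pi / 4\<close> the
      closed form continues with negative \<open>cos (2 * u)\<close> and leaves
      \<open>lemniscate_curve \<circ> h\<close>.\<close>
    show "(lemniscate_curve \<circ> h has_vector_derivative
        (- 2 * sin (2 * u) * (3 - (sin (2 * u))\<^sup>2) / (1 + (sin (2 * u))\<^sup>2)\<^sup>2,
         2 * (1 - 3 * (sin (2 * u))\<^sup>2) / (1 + (sin (2 * u))\<^sup>2)\<^sup>2)) (at u within {u\<^sub>0..pi / 4})"
      using u\<^sub>0
      by (intro has_vector_derivative_transform[OF u _ lemniscate_parametrization(1)])
        (simp add: h_def lemniscate_curve_arctan_sin)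
    have "(F has_real_derivative 2 * sqrt 2 * ((squircle_radius (pi / 4 - u))\<^sup>2 / 2)) (at u)"
    proof -
      have "((\<lambda>u. A (pi / 4 - u)) has_real_derivative (squircle_radius (pi / 4 - u))\<^sup>2 / 2 * (- 1)) (at u)"
        using u u\<^sub>0 by (intro DERIV_chain2[OF bspec[OF A']]) (auto intro!: derivative_eq_intros)
      from DERIV_cmult[OF this, of "- 2 * sqrt 2"] show ?thesis by (simp add: F_def[abs_def])
    qed
    moreover have "2 * (pi / 4 - u) = pi / 2 - 2 * u" by simp
    then have "2 * sqrt 2 * ((squircle_radius (pi / 4 - u))\<^sup>2 / 2) = 2 / sqrt (1 + (sin (2 * u))\<^sup>2)"
      unfolding squircle_radius_power2 by (simp only: cos_diff) simp
    ultimately show "(F has_real_derivative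
        norm (- 2 * sin (2 * u) * (3 - (sin (2 * u))\<^sup>2) / (1 + (sin (2 * u))\<^sup>2)\<^sup>2,
              2 * (1 - 3 * (sin (2 * u))\<^sup>2) / (1 + (sin (2 * u))\<^sup>2)\<^sup>2)) (at u within {u\<^sub>0..pi / 4})"
      unfolding lemniscate_parametrization(2) by (metis has_field_derivative_at_within)
  qed (rule lemniscate_parametrization(3))
  also have "F (pi / 4) - F u\<^sub>0 = 2 * a * sqrt 2"
    by (simp add: F_def A a u\<^sub>0_def)
  finally show ?thesis .
qed

end
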